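(* For every $i\ge 1$, the Adams operation $\psi^{3^{-1}}$ on $K_*\mathbb{CP}^\infty$ is given by $$\psi^{3^{-1}}\beta_i(T)=\beta_i(3T),$$ or, equivalently, as the Mahler series $$\psi^{3^{-1}}\binom{T}{i}=\binom{3T}{i}=\sum_{j\ge1}a_j\binom{T}{j},\qquad\text{where}\qquad a_j=\sum_{s+t=i-j}\binom{j}{s}\binom{s}{t}3^{j-t}.$$
   Context: $K$ is $2$-adic complex $K$-theory ($K(1)$-local at $p=2$), with $K_*$ regarded as concentrated in degree $0$ via Bott periodicity. Let $L$ be the tautological line bundle over $\mathbb{CP}^\infty$ and use the generator $x=L-1$ of $K^*\mathbb{CP}^\infty\cong\mathbb{Z}_2[\![x]\!]$; the module generators $\beta_i\in K_*\mathbb{CP}^\infty$ are dual to $x^i$. One identifies $K_*\mathbb{CP}^\infty$ with the ring of continuous functions $\mathbb{Z}_2\to\mathbb{Z}_2$ (the $2$-completion of the ring of numerical polynomials $\{f\in\mathbb{Q}[T]: f(\mathbb{Z})\subset\mathbb{Z}\}$), $\beta_i$ corresponding to the function $\beta_i(T)=\binom{T}{i}$. Every such function is uniquely a Mahler series $\sum_{j\ge0}a_j\binom{T}{j}$ with $a_j\to0$. The operation $\psi^{3^{-1}}$ on $K_*\mathbb{CP}^\infty$ is induced by the stable Adams operation on the $K$ factor, and is adjoint to $\psi^3$ on $K^0\mathbb{CP}^\infty$ (the ring map with $\psi^3(L)=L^3$) under the Kronecker pairing: $\langle\psi^3 a,b\rangle=\langle a,\psi^{3^{-1}}b\rangle$.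 In the formula for $a_j$ the sum is over integers $s,t\ge0$. *)

theory Defs
  imports Complex_Main "HOL-Computational_Algebra.Formal_Power_Series"
begin

section \<open>The ring of 2-adic integers\<close>

text \<open>The inverse limit of the rings of integers modulo \<open>2 ^ n\<close>; the \<open>n\<close>-th component of
  an element is its representative modulo \<open>2 ^ n\<close> in \<open>{0..<2 ^ n}\<close>.\<close>

typedef two_adic = "{x :: nat \<Rightarrow> int. (\<forall>n. x n mod 2 ^ n = x n) \<and> (\<forall>n. x (Suc n) mod 2 ^ n = x n)}"
  morphisms res Abs_two_adic
  by (rule exI[of _ "\<lambda>_. 0"]) simp

setup_lifting type_definition_two_adic

lemma res_mod: "res x n mod 2 ^ n = res x n"
  using res[of x] by blast

lemma res_Suc_mod: "res x (Suc n) mod 2 ^ n = res x n"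
  using res[of x] by blast

lemma res_mod_le: "m \<le> n \<Longrightarrow> res x n mod 2 ^ m = res x m"
proof (induction n rule: dec_induct)
  case base
  show ?case by (rule res_mod)
next
  case (step n)
  have "res x (Suc n) mod 2 ^ m = (res x (Suc n) mod 2 ^ n) mod 2 ^ m"
    using step.hyps by (simp add: mod_mod_cancel le_imp_power_dvd)
  then show ?case
    using step.IH by (simp add: res_Suc_mod)
qed

lemma res_0: "res x 0 = 0"
  using res_mod[of x 0] by simp

lemma two_adic_eqI: "(\<And>n. res x n = res y n) \<Longrightarrow> x = y"
  by (metis ext res_inject)

lemma mod_Suc_power_mod: "(a :: int) mod 2 ^ Suc n mod 2 ^ n = a mod 2 ^ n"
  by (rule mod_mod_cancel) simp

instantiation two_adic :: comm_ring_1
begin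

lift_definition zero_two_adic :: two_adic is "\<lambda>_. 0"
  by simp

lift_definition one_two_adic :: two_adic is "\<lambda>n. 1 mod 2 ^ n"
  by (simp only: mod_Suc_power_mod mod_mod_trivial simp_thms)

lift_definition plus_two_adic :: "two_adic \<Rightarrow> two_adic \<Rightarrow> two_adic"
  is "\<lambda>x y n. (x n + y n) mod 2 ^ n"
  by (simp only: mod_Suc_power_mod mod_mod_trivial simp_thms) (metis mod_add_eq)

lift_definition minus_two_adic :: "two_adic \<Rightarrow> two_adic \<Rightarrow> two_adic"
  is "\<lambda>x y n. (x n - y n) mod 2 ^ n"
  by (simp only: mod_Suc_power_mod mod_mod_trivial simp_thms) (metis mod_diff_eq)

lift_definition uminus_two_adic :: "two_adic \<Rightarrow> two_adic"
  is "\<lambda>x n. (- x n) mod 2 ^ n"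
  by (simp only: mod_Suc_power_mod mod_mod_trivial simp_thms) (metis mod_minus_eq)

lift_definition times_two_adic :: "two_adic \<Rightarrow> two_adic \<Rightarrow> two_adic"
  is "\<lambda>x y n. (x n * y n) mod 2 ^ n"
  by (simp only: mod_Suc_power_mod mod_mod_trivial simp_thms) (metis mod_mult_eq)

instance
proof
  show "(0 :: two_adic) \<noteq> 1"
  proof
    assume "(0 :: two_adic) = 1"
    then have "res 0 1 = res 1 1" by simp
    then show False by (simp add: zero_two_adic.rep_eq one_two_adic.rep_eq)
  qed
next
  fix a b c :: two_adic
  note rep = plus_two_adic.rep_eq minus_two_adic.rep_eq uminus_two_adic.rep_eq
    times_two_adic.rep_eq zero_two_adic.rep_eq one_two_adic.rep_eq
  show "a * b * c = a * (b * c)"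
    by (rule two_adic_eqI) (simp add: rep mod_simps mult.assoc)
  show "a * b = b * a"
    by (rule two_adic_eqI) (simp add: rep mult.commute)
  show "1 * a = a"
    by (rule two_adic_eqI) (simp only: rep mod_mult_left_eq mult_1 res_mod)
  show "a + b + c = a + (b + c)"
    by (rule two_adic_eqI) (simp add: rep mod_simps add.assoc)
  show "a + b = b + a"
    by (rule two_adic_eqI) (simp add: rep add.commute)
  show "0 + a = a"
    by (rule two_adic_eqI) (simp add: rep res_mod)
  show "- a + a = 0"
    by (rule two_adic_eqI) (simp add: rep mod_simps)
  show "a - b = a + - b"
    by (rule two_adic_eqI) (simp add: rep mod_simps)
  show "(a + b) * c = a * c + b * c"
    by (rule two_adic_eqI) (simp add: rep mod_simps distrib_right)
qed

end

lemma res_of_nat: "res (of_nat k) n = int k mod 2 ^ n"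
  by (induction k)
     (simp_all add: zero_two_adic.rep_eq plus_two_adic.rep_eq one_two_adic.rep_eq mod_simps)

instance two_adic :: ring_char_0
proof
  show "inj (of_nat :: nat \<Rightarrow> two_adic)"
  proof (rule injI)
    fix a b :: nat
    assume "(of_nat a :: two_adic) = of_nat b"
    then have "int a mod 2 ^ (a + b) = int b mod 2 ^ (a + b)"
      by (metis res_of_nat)
    moreover have "int a < 2 ^ (a + b)" "int b < 2 ^ (a + b)"
      using less_exp[of "a + b"] by (metis add_lessD1 add.commute of_nat_less_iff of_nat_numeral of_nat_power)+
    ultimately show "a = b" by simp
  qed
qed

instance two_adic :: idom
proof
  fix x y :: two_adic
  assume "x \<noteq> 0" "y \<noteq> 0"
  then obtain m k where m: "res x m \<noteq> 0" and k: "res y k \<noteq> 0"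
    by (metis two_adic_eqI zero_two_adic.rep_eq)
  let ?a = "res x (m + k)" and ?b = "res y (m + k)"
  have a: "\<not> 2 ^ m dvd ?a" and b: "\<not> 2 ^ k dvd ?b"
    using m k res_mod_le[of m "m + k" x] res_mod_le[of k "m + k" y] by (auto simp: dvd_eq_mod_eq_0)
  have "\<not> 2 ^ (m + k) dvd ?a * ?b"
  proof
    assume "2 ^ (m + k) dvd ?a * ?b"
    then obtain i j where ij: "i + j = m + k" "2 ^ i dvd ?a" "2 ^ j dvd ?b"
      using prime_elem_power_dvd_prod[of "2 :: int" "m + k" ?a ?b] by auto
    then have "m \<le> i \<or> k \<le> j" by linarith
    then show False
      using ij a b by (meson dvd_trans le_imp_power_dvd)
  qed
  then have "res (x * y) (m + k) \<noteq> 0"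
    by (simp add: times_two_adic.rep_eq dvd_eq_mod_eq_0)
  then show "x * y \<noteq> 0"
    by (metis zero_two_adic.rep_eq)
qed

lemma res_eq_of_nat: "res x n = res (of_nat (nat (res x n))) n"
proof -
  have "res x n \<ge> 0"
    by (metis res_mod pos_mod_sign zero_less_power zero_less_numeral)
  then show ?thesis by (simp add: res_of_nat res_mod del: of_nat_nat)
qed

lemma res_prod_cong:
  assumes "res x n = res y n"
  shows "res (\<Prod>i<k. x - of_nat i) n = res (\<Prod>i<k. y - of_nat i) n"
  using assms by (induction k) (simp_all add: times_two_adic.rep_eq minus_two_adic.rep_eq)

lemma fact_mult_choose_two_adic:
  "(\<Prod>i<k. of_nat t - of_nat i) = (fact k * of_nat (t choose k) :: two_adic)"
proof -
  have "real_of_int (\<Prod>i<k. int t - int i) = real_of_int (fact k * int (t choose k))"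
    using gbinomial_mult_fact[of k "real t"]
    by (simp add: binomial_gbinomial atLeast0LessThan)
  then have "(\<Prod>i<k. int t - int i) = fact k * int (t choose k)"
    by (simp only: of_int_eq_iff)
  then have "(of_int (\<Prod>i<k. int t - int i) :: two_adic) = of_int (fact k * int (t choose k))"
    by simp
  then show ?thesis by simp
qed

lemma fact_dvd_prod_two_adic:
  fixes T :: two_adic
  shows "fact k dvd (\<Prod>i<k. T - of_nat i)"
proof -
  obtain m u where mu: "(fact k :: int) = 2 ^ m * u" "\<not> 2 dvd u"
    by (rule multiplicity_decompose'[of "fact k :: int" 2]) auto
  define t where "t n = nat (res T (n + m))" for n
  have *: "res (\<Prod>i<k. T - of_nat i) (n + m) = fact k * int (t n choose k) mod 2 ^ (n + m)" for n
  proof -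
    have "res (\<Prod>i<k. T - of_nat i) (n + m) = res (\<Prod>i<k. of_nat (t n) - of_nat i) (n + m)"
      unfolding t_def by (rule res_prod_cong) (rule res_eq_of_nat)
    also have "\<dots> = res (of_nat (fact k * (t n choose k))) (n + m)"
      by (simp add: fact_mult_choose_two_adic)
    finally show ?thesis unfolding res_of_nat by (simp only: of_nat_mult of_nat_fact)
  qed
  have coh: "int (t (Suc n) choose k) mod 2 ^ n = int (t n choose k) mod 2 ^ n" for n
  proof -
    have "fact k * int (t (Suc n) choose k) mod 2 ^ (n + m) = fact k * int (t n choose k) mod 2 ^ (n + m)"
      using *[of n] *[of "Suc n"] res_Suc_mod[of _ "n + m"] mod_Suc_power_mod[of _ "n + m"]
      by (metis add_Suc)
    then have "2 ^ (n + m) dvd fact k * (int (t (Suc n) choose k) - int (t n choose k))"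
      by (simp add: mod_eq_dvd_iff right_diff_distrib)
    then have "2 ^ n dvd u * (int (t (Suc n) choose k) - int (t n choose k))"
      by (simp add: mu power_add mult.assoc mult.commute[of "2 ^ n"])
    moreover have "coprime (2 ^ n) u"
      using mu(2) by (simp add: coprime_left_2_iff_odd)
    ultimately show ?thesis
      by (simp add: coprime_dvd_mult_right_iff mod_eq_dvd_iff)
  qed
  define y where "y = Abs_two_adic (\<lambda>n. int (t n choose k) mod 2 ^ n)"
  have y: "res y n = int (t n choose k) mod 2 ^ n" for n
    unfolding y_def by (subst Abs_two_adic_inverse) (auto simp: mod_Suc_power_mod coh simp del: power_Suc)
  have "(\<Prod>i<k. T - of_nat i) = fact k * y"
  proof (rule two_adic_eqI)
    fix n
    have "res (\<Prod>i<k. T - of_nat i) n = fact k * int (t n choose k) mod 2 ^ (n + m) mod 2 ^ n"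
      using *[of n] res_mod_le[of n "n + m"] by (metis le_add1)
    also have "\<dots> = fact k * int (t n choose k) mod 2 ^ n"
      by (rule mod_mod_cancel) (simp add: power_add)
    also have "\<dots> = res (fact k * y) n"
      using res_of_nat[of "fact k" n] by (simp add: times_two_adic.rep_eq y mod_simps)
    finally show "res (\<Prod>i<k. T - of_nat i) n = res (fact k * y) n" .
  qed
  then show ?thesis by simp
qed

text \<open>The 2-adic metric: if \<open>x \<noteq> y\<close>, the exponent below is the 2-adic valuation of \<open>x - y\<close>.\<close>

instantiation two_adic :: metric_space
begin

definition dist_two_adic :: "two_adic \<Rightarrow> two_adic \<Rightarrow> real" where
  "dist x y = (if x = y then 0 else (1 / 2) ^ (LEAST n. res x (Suc n) \<noteq> res y (Suc n)))"

definition uniformity_two_adic :: "(two_adic \<times> two_adic) filter" where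
  "uniformity_two_adic = (INF e\<in>{0<..}. principal {(x, y). dist x y < e})"

definition open_two_adic :: "two_adic set \<Rightarrow> bool" where
  "open_two_adic U = (\<forall>x\<in>U. eventually (\<lambda>(x', y). x' = x \<longrightarrow> y \<in> U) uniformity)"

instance
proof
  have res_neq: "\<exists>n. res x (Suc n) \<noteq> res y (Suc n)" if "x \<noteq> y" for x y
  proof -
    obtain n where n: "res x n \<noteq> res y n"
      using \<open>x \<noteq> y\<close> two_adic_eqI by blast
    then show ?thesis by (cases n) (auto simp: res_0)
  qed
  fix x y z :: two_adic
  show "dist x y = 0 \<longleftrightarrow> x = y"
    by (simp add: dist_two_adic_def)
  define v where "v a b = (LEAST n. res a (Suc n) \<noteq> res b (Suc n))" for a b
  have dist_v: "dist a b = (if a = b then 0 else (1 / 2) ^ v a b)" for a b :: two_adic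
    unfolding dist_two_adic_def v_def by (rule refl)
  have v: "res a (Suc (v a b)) \<noteq> res b (Suc (v a b))" if "a \<noteq> b" for a b
    unfolding v_def by (rule LeastI_ex[of "\<lambda>n. res a (Suc n) \<noteq> res b (Suc n)"]) (rule res_neq[OF that])
  have v_le: "v a b \<le> n" if "res a (Suc n) \<noteq> res b (Suc n)" for a b n
    unfolding v_def by (rule Least_le[of "\<lambda>n. res a (Suc n) \<noteq> res b (Suc n)"]) (rule that)
  have v_commute: "v a b = v b a" for a b
    unfolding v_def by (simp add: eq_commute)
  show "dist x y \<le> dist x z + dist y z"
  proof (cases "x = y \<or> x = z \<or> y = z")
    case True
    then show ?thesis using v_commute[of x y] by (elim disjE) (simp_all add: dist_v)
  next
    case False
    have "v x z \<le> v x y \<or> v y z \<le> v x y"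
      using v[of x y] v_le[of x "v x y" z] v_le[of y "v x y" z] False by metis
    then have "(1 / 2 :: real) ^ v x y \<le> (1 / 2) ^ v x z \<or> (1 / 2 :: real) ^ v x y \<le> (1 / 2) ^ v y z"
      by (elim disjE) (simp_all add: power_decreasing)
    moreover have "(1 / 2 :: real) ^ v x z \<ge> 0" "(1 / 2 :: real) ^ v y z \<ge> 0"
      by simp_all
    ultimately have "(1 / 2 :: real) ^ v x y \<le> (1 / 2) ^ v x z + (1 / 2) ^ v y z"
      by linarith
    then show ?thesis using False by (simp add: dist_v)
  qed
qed (rule uniformity_two_adic_def open_two_adic_def)+

end


section \<open>2-adic K-theory of infinite complex projective space\<close>

text \<open>\<open>K\<^sup>*\<close> is the power series ring over the 2-adic integers in \<open>x = L - 1\<close>, so \<open>x\<close> is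
  \<open>fps_X\<close>.  \<open>K\<^sub>*\<close> is the ring of continuous functions from the 2-adic integers to themselves.\<close>

type_synonym K_cohomology = "two_adic fps"

definition taut_line_bundle :: K_cohomology where
  "taut_line_bundle = 1 + fps_X"

definition K_homology :: "(two_adic \<Rightarrow> two_adic) set" where
  "K_homology = {f. continuous_on UNIV f}"

text \<open>\<open>beta i T\<close> is the binomial coefficient of \<open>T\<close> over \<open>i\<close>, that is
  \<open>T (T - 1) \<dots> (T - i + 1) / i!\<close>; this quotient exists in the 2-adic integers, see
  \<open>fact_mult_beta\<close>.  The library's \<open>gchoose\<close> is not available, as it requires a field.\<close>

definition beta :: "nat \<Rightarrow> two_adic \<Rightarrow> two_adic" where
  "beta i T = (THE y. fact i * y = (\<Prod>k<i. T - of_nat k))"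

lemma fact_mult_beta: "fact i * beta i T = (\<Prod>k<i. T - of_nat k)"
proof -
  have "\<exists>!y. fact i * y = (\<Prod>k<i. T - of_nat k)"
    using fact_dvd_prod_two_adic[of i T] by (auto simp: dvd_def)
  then show ?thesis
    unfolding beta_def by (rule theI')
qed

lemma beta_of_nat: "beta i (of_nat n) = of_nat (n choose i)"
proof -
  have "fact i * beta i (of_nat n) = fact i * of_nat (n choose i)"
    by (simp only: fact_mult_beta fact_mult_choose_two_adic)
  then show ?thesis by simp
qed

definition has_mahler_series :: "(two_adic \<Rightarrow> two_adic) \<Rightarrow> (nat \<Rightarrow> two_adic) \<Rightarrow> bool" where
  "has_mahler_series f a \<longleftrightarrow> a \<longlonglongrightarrow> 0 \<and> (\<forall>T. (\<lambda>j. a j * beta j T) sums f T)"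

definition mahler_coeff :: "(two_adic \<Rightarrow> two_adic) \<Rightarrow> nat \<Rightarrow> two_adic" where
  "mahler_coeff f = (THE a. has_mahler_series f a)"

text \<open>The pairing for which the \<open>beta j\<close> are dual to the powers \<open>x\<^sup>j\<close>.  The series converges
  because the Mahler coefficients of a continuous function tend to \<open>0\<close>.\<close>

definition kronecker :: "K_cohomology \<Rightarrow> (two_adic \<Rightarrow> two_adic) \<Rightarrow> two_adic" where
  "kronecker b f = (\<Sum>j. fps_nth b j * mahler_coeff f j)"

text \<open>A ring endomorphism of the power series ring is determined by its value on \<open>L\<close>: it is
  automatically linear over the 2-adic integers, and continuous since \<open>L\<^sup>3 - 1\<close> is divisible
  by \<open>x\<close>.\<close>

definition is_adams_psi3 :: "(K_cohomology \<Rightarrow> K_cohomology) \<Rightarrow> bool" where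
  "is_adams_psi3 \<psi> \<longleftrightarrow>
     \<psi> 1 = 1 \<and> (\<forall>a b. \<psi> (a + b) = \<psi> a + \<psi> b) \<and> (\<forall>a b. \<psi> (a * b) = \<psi> a * \<psi> b) \<and>
     \<psi> taut_line_bundle = taut_line_bundle ^ 3"

definition is_kronecker_adjoint ::
    "(K_cohomology \<Rightarrow> K_cohomology) \<Rightarrow> ((two_adic \<Rightarrow> two_adic) \<Rightarrow> (two_adic \<Rightarrow> two_adic)) \<Rightarrow> bool" where
  "is_kronecker_adjoint \<psi> \<phi> \<longleftrightarrow>
     (\<forall>f\<in>K_homology. \<phi> f \<in> K_homology) \<and>
     (\<forall>a. \<forall>f\<in>K_homology. kronecker (\<psi> a) f = kronecker a (\<phi> f))"

text \<open>The summation condition is \<open>s + t = i - j\<close>, with the sum empty for \<open>j > i\<close>.  The truncated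
  exponent is harmless: the binomial coefficients vanish unless \<open>t \<le> s \<le> j\<close>.\<close>

definition mahler_a :: "nat \<Rightarrow> nat \<Rightarrow> nat" where
  "mahler_a i j = (\<Sum>(s, t) \<in> {(s, t). s + t + j = i}. (j choose s) * (s choose t) * 3 ^ (j - t))"

end

theory Submission
  imports Defs
begin

text \<open>Pairing with \<open>x ^ j\<close> extracts the \<open>j\<close>-th Mahler coefficient, so by adjointness the \<open>j\<close>-th
  coefficient of \<open>psi3_inv (beta i)\<close> is the coefficient of \<open>x ^ i\<close> in \<open>((1 + x)\<^sup>3 - 1) ^ j\<close>.
  These are also the coefficients of \<open>beta i (3 * T)\<close>, as one sees at natural numbers \<open>T = n\<close>
  by expanding \<open>(1 + x) ^ (3 * n)\<close> in powers of \<open>(1 + x)\<^sup>3 - 1\<close>.  Equal coefficients give equal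
  functions by Mahler's theorem: continuous functions have Mahler series because, modulo \<open>2 ^ s\<close>,
  they have some period \<open>2 ^ t\<close>, so that \<open>2 ^ t\<close> differencings produce a factor 2.\<close>

section \<open>Congruences and the 2-adic topology\<close>

lemma res_eq_mono: "res x n = res y n \<Longrightarrow> m \<le> n \<Longrightarrow> res x m = res y m"
  by (metis res_mod_le)

lemma res_minus_eq_0_iff: "res (x - y) n = 0 \<longleftrightarrow> res x n = res y n"
proof -
  have "res (x - y) n = 0 \<longleftrightarrow> res x n mod 2 ^ n = res y n mod 2 ^ n"
    by (simp add: minus_two_adic.rep_eq mod_eq_dvd_iff dvd_eq_mod_eq_0)
  then show ?thesis by (simp only: res_mod)
qed

lemma res_add_cong:
  "res x n = res x' n \<Longrightarrow> res y n = res y' n \<Longrightarrow> res (x + y) n = res (x' + y') n"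
  by (simp add: plus_two_adic.rep_eq)

lemma res_diff_cong:
  "res x n = res x' n \<Longrightarrow> res y n = res y' n \<Longrightarrow> res (x - y) n = res (x' - y') n"
  by (simp add: minus_two_adic.rep_eq)

lemma res_mult_cong:
  "res x n = res x' n \<Longrightarrow> res y n = res y' n \<Longrightarrow> res (x * y) n = res (x' * y') n"
  by (simp add: times_two_adic.rep_eq)

lemma res_zero [simp]: "res 0 n = 0"
  by (simp add: zero_two_adic.rep_eq)

lemma res_sum_cong:
  assumes "\<And>j. j \<in> A \<Longrightarrow> res (f j) n = res (g j) n"
  shows "res (sum f A) n = res (sum g A) n"
  using assms by (induction A rule: infinite_finite_induct) (auto intro!: res_add_cong)

lemma res_of_int: "res (of_int k) n = k mod 2 ^ n"
proof (cases k)
  case (nonneg m)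
  then show ?thesis by (simp add: res_of_nat)
next
  case (neg m)
  have "res (of_int k) n = (0 - int (Suc m) mod 2 ^ n) mod 2 ^ n"
    using res_of_nat[of "Suc m" n] neg minus_two_adic.rep_eq[of 0 "of_nat (Suc m)"] by simp
  also have "\<dots> = k mod 2 ^ n"
    using neg by (metis diff_0 mod_minus_eq)
  finally show ?thesis .
qed

text \<open>With \<open>k = 2 ^ m * u\<close> and \<open>u\<close> odd, \<open>u\<close> is
  invertible modulo \<open>2 ^ n\<close>, so cancelling \<open>k\<close> costs just \<open>m\<close>
  binary digits, whatever \<open>x\<close> and \<open>n\<close> are.\<close>

lemma res_of_int_mult_eq_0_cancel:
  assumes "k \<noteq> 0"
  obtains m where "\<And>x n. res (of_int k * x) (n + m) = 0 \<Longrightarrow> res x n = 0"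
proof -
  obtain m u where mu: "k = 2 ^ m * u" "\<not> 2 dvd u"
    using assms by (rule multiplicity_decompose'[of k 2]) auto
  have "res x n = 0" if "res (of_int k * x) (n + m) = 0" for x n
  proof -
    have "2 ^ (n + m) dvd k * res x (n + m)"
      using that by (simp add: times_two_adic.rep_eq res_of_int mod_mult_left_eq dvd_eq_mod_eq_0)
    then have "2 ^ n dvd u * res x (n + m)"
      by (simp add: mu power_add mult.assoc mult.commute[of "2 ^ n"])
    moreover have "coprime (2 ^ n) u"
      using mu(2) by (simp add: coprime_left_2_iff_odd)
    ultimately have "2 ^ n dvd res x (n + m)"
      by (simp add: coprime_dvd_mult_right_iff)
    then show ?thesis
      by (metis dvd_eq_mod_eq_0 le_add1 res_mod_le)
  qed
  then show thesis by (rule that)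
qed

text \<open>A multiple of \<open>2 ^ n\<close> doubles to a multiple of \<open>2 ^ Suc n\<close>.
  This gained digit drives the induction for periodic sequences.\<close>

lemma res_double_eq_0:
  assumes "res x n = 0"
  shows "res (2 * x) (Suc n) = 0"
proof -
  have "2 ^ n dvd res x (Suc n)"
    using assms res_Suc_mod[of x n] by (simp add: dvd_eq_mod_eq_0)
  then have "2 ^ Suc n dvd (res x (Suc n) + res x (Suc n))"
    by (auto simp: dvd_def)
  then show ?thesis
    unfolding mult_2 plus_two_adic.rep_eq by (rule dvd_imp_mod_0)
qed

section \<open>The metric topology in terms of residues\<close>

lemma dist_two_adic_less_iff:
  "dist x y < (1 / 2) ^ n \<longleftrightarrow> res x (Suc n) = res y (Suc n)"
proof (cases "x = y")
  case False
  then obtain k where "res x k \<noteq> res y k"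
    using two_adic_eqI by blast
  then have ex: "\<exists>k. res x (Suc k) \<noteq> res y (Suc k)"
    by (cases k) (auto simp: res_0)
  define v where "v = (LEAST k. res x (Suc k) \<noteq> res y (Suc k))"
  have v: "res x (Suc v) \<noteq> res y (Suc v)"
    unfolding v_def by (rule LeastI_ex[OF ex])
  \<comment> \<open>Residues at level 0 always agree, so \<open>v\<close> counts from level 1; this
    is why radius \<open>(1 / 2) ^ n\<close> corresponds to level \<open>Suc n\<close>.\<close>
  have "n < v \<longleftrightarrow> res x (Suc n) = res y (Suc n)"
    using v res_eq_mono[of x "Suc n" y "Suc v"]
      not_less_Least[of n "\<lambda>k. res x (Suc k) \<noteq> res y (Suc k)"]
    unfolding v_def[symmetric] by (metis Suc_le_mono not_le)
  moreover have "dist x y = (1 / 2) ^ v"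
    using False by (simp add: dist_two_adic_def v_def)
  ultimately show ?thesis
    by (simp add: power_strict_decreasing_iff)
qed simp

text \<open>Residue classes modulo \<open>2 ^ Suc n\<close> are the balls of radius
  \<open>(1 / 2) ^ n\<close>, and these radii become arbitrarily small; so moduli can replace
  epsilons.\<close>

lemma eventually_res_eq_iff:
  fixes l :: two_adic
  shows "(g \<longlongrightarrow> l) F \<longleftrightarrow> (\<forall>s. eventually (\<lambda>x. res (g x) s = res l s) F)"
proof
  assume "(g \<longlongrightarrow> l) F"
  show "\<forall>s. eventually (\<lambda>x. res (g x) s = res l s) F"
  proof
    fix s
    have "eventually (\<lambda>x. dist (g x) l < (1 / 2) ^ s) F"
      using \<open>(g \<longlongrightarrow> l) F\<close> by (rule tendstoD) simp
    then show "eventually (\<lambda>x. res (g x) s = res l s) F"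
      by eventually_elim (metis dist_two_adic_less_iff res_eq_mono le_SucI order_refl)
  qed
next
  assume *: "\<forall>s. eventually (\<lambda>x. res (g x) s = res l s) F"
  show "(g \<longlongrightarrow> l) F"
  proof (rule tendstoI)
    fix e :: real
    assume "0 < e"
    then obtain n where n: "(1 / 2) ^ n < e"
      using real_arch_pow_inv[of e "1 / 2"] by auto
    have "eventually (\<lambda>x. res (g x) (Suc n) = res l (Suc n)) F"
      using * by blast
    then show "eventually (\<lambda>x. dist (g x) l < e) F"
      by eventually_elim (metis dist_two_adic_less_iff n less_trans)
  qed
qed

lemma continuous_on_two_adic_iff:
  fixes f :: "two_adic \<Rightarrow> two_adic"
  shows "continuous_on UNIV f \<longleftrightarrow>
    (\<forall>x s. \<exists>n. \<forall>y. res y n = res x n \<longrightarrow> res (f y) s = res (f x) s)"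
proof -
  have "eventually (\<lambda>y. res (f y) s = res (f x) s) (at x) \<longleftrightarrow>
      (\<exists>n. \<forall>y. res y n = res x n \<longrightarrow> res (f y) s = res (f x) s)" for x s
  proof
    assume "eventually (\<lambda>y. res (f y) s = res (f x) s) (at x)"
    then obtain d where d: "d > 0" "\<And>y. y \<noteq> x \<Longrightarrow> dist y x < d \<Longrightarrow> res (f y) s = res (f x) s"
      by (auto simp: eventually_at)
    obtain n where n: "(1 / 2) ^ n < d"
      using real_arch_pow_inv[of d "1 / 2"] d(1) by auto
    have "res (f y) s = res (f x) s" if "res y (Suc n) = res x (Suc n)" for y
      using d(2)[of y] that n dist_two_adic_less_iff[of y x n] by fastforce
    then show "\<exists>n. \<forall>y. res y n = res x n \<longrightarrow> res (f y) s = res (f x) s"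
      by blast
  next
    assume "\<exists>n. \<forall>y. res y n = res x n \<longrightarrow> res (f y) s = res (f x) s"
    then obtain n where n: "\<And>y. res y n = res x n \<Longrightarrow> res (f y) s = res (f x) s"
      by blast
    have "res (f y) s = res (f x) s" if "dist y x < (1 / 2) ^ n" for y
    proof (rule n)
      show "res y n = res x n"
        using that unfolding dist_two_adic_less_iff by (rule res_eq_mono) simp
    qed
    moreover have "(1 / 2 :: real) ^ n > 0"
      by simp
    ultimately show "eventually (\<lambda>y. res (f y) s = res (f x) s) (at x)"
      unfolding eventually_at by blast
  qed
  then show ?thesis
    by (simp add: continuous_on_def eventually_res_eq_iff)
qed

text \<open>Koenig's lemma: if no common modulus works, then repeatedly choosing a residue class on
  which none works yields a point at which \<open>f\<close> is not continuous.\<close>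

lemma continuous_on_imp_uniform_res:
  fixes f :: "two_adic \<Rightarrow> two_adic"
  assumes "continuous_on UNIV f"
  obtains m where "\<And>y z. res y m = res z m \<Longrightarrow> res (f y) s = res (f z) s"
proof -
  define works where "works n r m \<longleftrightarrow>
    (\<forall>y z. res y n = r \<longrightarrow> res y m = res z m \<longrightarrow> res (f y) s = res (f z) s)" for n r m
  have works_mono: "works n r m'" if "works n r m" "m \<le> m'" for n r m m'
    using that unfolding works_def by (metis res_eq_mono)
  \<comment> \<open>At level 0 the class of 0 is the whole ring, so this is the claim.\<close>
  have "\<exists>m. works 0 0 m"
  proof (rule ccontr)
    assume root: "\<not> (\<exists>m. works 0 0 m)"
    have step: "\<exists>r'. (\<forall>m. \<not> works (Suc n) r' m) \<and> r' mod 2 ^ n = r"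
      if "\<forall>m. \<not> works n r m" for n r
    proof (rule ccontr)
      assume "\<not> ?thesis"
      then have "\<forall>r'. \<exists>m. r' mod 2 ^ n = r \<longrightarrow> works (Suc n) r' m"
        by blast
      then obtain M where M: "\<And>r'. r' mod 2 ^ n = r \<Longrightarrow> works (Suc n) r' (M r')"
        by metis
      \<comment> \<open>Finitely many classes at level \<open>Suc n\<close> refine \<open>r\<close>,
        and the largest of their moduli would serve all of \<open>r\<close>. Residues not above
        \<open>r\<close> only enlarge the maximum.\<close>
      define N where "N = Max (M ` {0..<2 ^ Suc n})"
      have "works n r N"
        unfolding works_def
      proof (intro allI impI)
        fix y z
        assume yz: "res y n = r" "res y N = res z N"
        have "res y (Suc n) \<in> {0..<2 ^ Suc n}"
          by (metis atLeastLessThan_iff pos_mod_bound pos_mod_sign res_mod zero_less_numeral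
              zero_less_power)
        then have "M (res y (Suc n)) \<le> N"
          unfolding N_def by (intro Max_ge) auto
        moreover have "works (Suc n) (res y (Suc n)) (M (res y (Suc n)))"
          using yz(1) by (intro M) (simp add: res_Suc_mod)
        ultimately have "works (Suc n) (res y (Suc n)) N"
          using works_mono by blast
        then show "res (f y) s = res (f z) s"
          using yz(2) unfolding works_def by blast
      qed
      then show False using that by blast
    qed
    obtain r where r: "r 0 = 0" "\<And>n m. \<not> works n (r n) m" "\<And>n. r (Suc n) mod 2 ^ n = r n"
    proof -
      have "\<exists>r. \<forall>n. (\<forall>m. \<not> works n (r n) m) \<and> (n = 0 \<longrightarrow> r n = 0) \<and> r (Suc n) mod 2 ^ n = r n"
        using dependent_nat_choice[of "\<lambda>n r. (\<forall>m. \<not> works n r m) \<and> (n = 0 \<longrightarrow> r = 0)"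
            "\<lambda>n r r'. r' mod 2 ^ n = r"] root step by auto
      then show thesis using that by blast
    qed
    define x where "x = Abs_two_adic r"
    have "r n mod 2 ^ n = r n" for n
      by (metis r(3) mod_mod_trivial)
    then have x: "res x n = r n" for n
      unfolding x_def by (subst Abs_two_adic_inverse) (auto simp: r(3))
    obtain n where n: "\<And>y. res y n = res x n \<Longrightarrow> res (f y) s = res (f x) s"
      using assms unfolding continuous_on_two_adic_iff by blast
    \<comment> \<open>Here \<open>y\<close> and \<open>z\<close> both lie in the class of
      \<open>x\<close> at level \<open>n\<close>, so \<open>f\<close> agrees at both with
      \<open>f x\<close> modulo \<open>2 ^ s\<close>.\<close>
    have "works n (r n) n"
      unfolding works_def using n x by metis
    then show False using r(2) by blast
  qed
  then show thesis
    using that unfolding works_def by (metis res_0)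
qed


section \<open>Mahler's theorem\<close>

text \<open>The product \<open>fact i * beta i x\<close> is an integer polynomial in
  \<open>x\<close> and so respects congruences; dividing by \<open>fact i\<close> loses a number of
  digits depending on \<open>i\<close> alone.\<close>

lemma beta_res_cong:
  obtains m where "\<And>x y n. res x (n + m) = res y (n + m) \<Longrightarrow> res (beta i x) n = res (beta i y) n"
proof -
  obtain m where m: "\<And>z n. res (of_int (fact i) * z) (n + m) = 0 \<Longrightarrow> res z n = 0"
    by (rule res_of_int_mult_eq_0_cancel[OF fact_nonzero[of i]]) blast
  have "res (beta i x) n = res (beta i y) n" if "res x (n + m) = res y (n + m)" for x y n
  proof -
    have "res (of_int (fact i) * (beta i x - beta i y)) (n + m) = 0"
      using res_prod_cong[OF that, of i]
      by (simp add: right_diff_distrib fact_mult_beta res_minus_eq_0_iff)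
    then show ?thesis
      using m res_minus_eq_0_iff by blast
  qed
  then show thesis by (rule that)
qed

lemma continuous_on_beta: "continuous_on UNIV (beta i)"
  unfolding continuous_on_two_adic_iff by (metis beta_res_cong)

section \<open>Forward differences and Newton's formula\<close>

definition fwd_diff :: "(nat \<Rightarrow> 'a :: ab_group_add) \<Rightarrow> nat \<Rightarrow> 'a" where
  "fwd_diff h x = h (Suc x) - h x"

lemma fwd_diff_pow_diff:
  "(fwd_diff ^^ n) (\<lambda>x. f x - g x) = (\<lambda>x. (fwd_diff ^^ n) f x - (fwd_diff ^^ n) g x)"
  by (induction n) (auto simp: fwd_diff_def)

lemma fwd_diff_pow_add:
  "(fwd_diff ^^ n) (\<lambda>x. f x + g x) = (\<lambda>x. (fwd_diff ^^ n) f x + (fwd_diff ^^ n) g x)"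
  by (induction n) (auto simp: fwd_diff_def)

lemma fwd_diff_pow_shift: "(fwd_diff ^^ n) (\<lambda>x. h (x + q)) = (\<lambda>x. (fwd_diff ^^ n) h (x + q))"
  by (induction n) (auto simp: fwd_diff_def)

lemma fwd_diff_pow_mult:
  fixes h :: "nat \<Rightarrow> 'a :: comm_ring_1"
  shows "(fwd_diff ^^ n) (\<lambda>x. c * h x) = (\<lambda>x. c * (fwd_diff ^^ n) h x)"
  by (induction n) (auto simp: fwd_diff_def right_diff_distrib)

text \<open>The expansions of \<open>h\<close> and of \<open>fwd_diff h\<close> at \<open>n\<close>
  add up to that of \<open>h\<close> at \<open>Suc n\<close> by Pascal's rule; hence the induction
  generalizes over \<open>h\<close>.\<close>

lemma newton_forward:
  fixes h :: "nat \<Rightarrow> 'a :: comm_ring_1"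
  shows "h n = (\<Sum>j\<le>n. of_nat (n choose j) * (fwd_diff ^^ j) h 0)"
proof (induction n arbitrary: h)
  case (Suc n)
  have "h (Suc n) = h n + fwd_diff h n"
    by (simp add: fwd_diff_def)
  also have "h n = (\<Sum>j\<le>Suc n. of_nat (n choose j) * (fwd_diff ^^ j) h 0)"
    by (subst Suc.IH) (simp add: binomial_eq_0)
  also have "\<dots> = h 0 + (\<Sum>j\<le>n. of_nat (n choose Suc j) * (fwd_diff ^^ Suc j) h 0)"
    by (subst sum.atMost_Suc_shift) simp
  also have "fwd_diff h n = (\<Sum>j\<le>n. of_nat (n choose j) * (fwd_diff ^^ Suc j) h 0)"
    by (subst Suc.IH) (simp only: funpow_Suc_right o_apply)
  finally show ?case
    by (subst sum.atMost_Suc_shift)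
       (simp add: sum.distrib[symmetric] distrib_right[symmetric] add.assoc add.commute)
qed simp

text \<open>With \<open>E\<close> the shift, this is \<open>(E - 1) ^ 2 ^ t = E ^ 2 ^ t - 1\<close> modulo 2.\<close>

lemma fwd_diff_pow_2_power:
  fixes h :: "nat \<Rightarrow> 'a :: comm_ring_1"
  assumes "h \<in> S"
    and diff: "\<And>f g. f \<in> S \<Longrightarrow> g \<in> S \<Longrightarrow> (\<lambda>x. f x - g x) \<in> S"
    and shift: "\<And>f q. f \<in> S \<Longrightarrow> (\<lambda>x. f (x + q)) \<in> S"
  shows "\<exists>g\<in>S. (fwd_diff ^^ (2 ^ t)) h = (\<lambda>x. h (x + 2 ^ t) - h x + 2 * g x)"
  using \<open>h \<in> S\<close>
proof (induction t arbitrary: h)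
  case 0
  have "(\<lambda>x. h x - h x) \<in> S"
    using 0 by (intro diff)
  then show ?case
    by (intro bexI[of _ "\<lambda>x. h x - h x"]) (auto simp: fwd_diff_def)
next
  case (Suc t)
  let ?q = "2 ^ t :: nat"
  obtain g where g: "g \<in> S" "(fwd_diff ^^ ?q) h = (\<lambda>x. h (x + ?q) - h x + 2 * g x)"
    using Suc by blast
  have D: "fwd_diff f \<in> S" if "f \<in> S" for f
    using diff[OF shift[OF that, of 1] that] by (simp add: fwd_diff_def[abs_def])
  have Dn: "(fwd_diff ^^ n) f \<in> S" if "f \<in> S" for f n
    using that by (induction n) (auto intro: D)
  \<comment> \<open>Differencing again produces \<open>h (x + 2 * ?q) - 2 * h (x + ?q) + h x\<close>
    plus even terms. Up to even terms this is \<open>h (x + 2 * ?q) - h x\<close>, and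
    \<open>?g'\<close> collects everything even.\<close>
  let ?g' = "\<lambda>x. g (x + ?q) - g x - ((h (x + ?q) - h x) - (fwd_diff ^^ ?q) g x)"
  have "?g' \<in> S"
    by (intro diff shift g(1) Suc.prems Dn)
  moreover have "(fwd_diff ^^ (2 ^ Suc t)) h = (\<lambda>x. h (x + 2 ^ Suc t) - h x + 2 * ?g' x)"
  proof -
    have "(fwd_diff ^^ (2 ^ Suc t)) h = (fwd_diff ^^ ?q) ((fwd_diff ^^ ?q) h)"
      by (simp add: mult_2 funpow_add)
    also have "\<dots> = (\<lambda>x. (fwd_diff ^^ ?q) h (x + ?q) - (fwd_diff ^^ ?q) h x
        + 2 * (fwd_diff ^^ ?q) g x)"
      by (subst g(2)) (simp only: fwd_diff_pow_add fwd_diff_pow_diff fwd_diff_pow_mult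
          fwd_diff_pow_shift)
    also have "\<dots> = (\<lambda>x. h (x + ?q + ?q) - h x + 2 * ?g' x)"
    proof
      have "(a - b + 2 * c) - (b - d + 2 * e) + 2 * f = a - d + 2 * (c - e - ((b - d) - f))"
        for a b c d e f :: 'a
        by (simp add: algebra_simps)
      then show "(fwd_diff ^^ ?q) h (x + ?q) - (fwd_diff ^^ ?q) h x + 2 * (fwd_diff ^^ ?q) g x =
          h (x + ?q + ?q) - h x + 2 * ?g' x" for x
        by (simp only: g(2))
    qed
    also have "\<dots> = (\<lambda>x. h (x + 2 ^ Suc t) - h x + 2 * ?g' x)"
      by (simp only: power_Suc mult_2 add.assoc)
    finally show ?thesis .
  qed
  ultimately show ?case
    by - (rule bexI[of _ ?g'])
qed

lemma res_fwd_diff_pow_eq_0: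
  assumes "\<And>x. res (h x) s = 0"
  shows "res ((fwd_diff ^^ n) h x) s = 0"
  using assms by (induction n arbitrary: x) (simp_all add: fwd_diff_def res_minus_eq_0_iff)

text \<open>Each block of \<open>2 ^ t\<close> differencings leaves a part that vanishes modulo
  \<open>2 ^ s\<close> by periodicity and a part twice a periodic sequence, so \<open>m\<close>
  blocks give divisibility by \<open>2 ^ m\<close>.\<close>

lemma res_fwd_diff_pow_periodic:
  assumes "\<And>x. res (h (x + 2 ^ t)) s = res (h x) s" and "m \<le> s"
  shows "res ((fwd_diff ^^ (m * 2 ^ t)) h x) m = 0"
  using assms
proof (induction m arbitrary: h x)
  case 0
  show ?case by (simp add: res_0)
next
  case (Suc m)
  let ?q = "2 ^ t :: nat"
  \<comment> \<open>Periodicity modulo \<open>2 ^ s\<close> is stable under differences and shifts,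
    so the remainder \<open>g\<close> inherits it and the induction hypothesis applies to
    \<open>g\<close>.\<close>
  let ?S = "{h. \<forall>x. res (h (x + ?q)) s = res (h x) s}"
  have "\<exists>g\<in>?S. (fwd_diff ^^ ?q) h = (\<lambda>x. h (x + ?q) - h x + 2 * g x)"
  proof (rule fwd_diff_pow_2_power)
    show "h \<in> ?S"
      using Suc.prems(1) by simp
    show "(\<lambda>x. f x - g x) \<in> ?S" if "f \<in> ?S" "g \<in> ?S" for f g
      using that by (auto intro!: res_diff_cong)
    show "(\<lambda>x. f (x + k)) \<in> ?S" if "f \<in> ?S" for f k
    proof -
      have "res (f (x + ?q)) s = res (f x) s" for x
        using that by simp
      moreover have "x + ?q + k = x + k + ?q" for x
        by simp
      ultimately show ?thesis
        by (simp only: mem_Collect_eq) simp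
    qed
  qed
  then obtain g where g: "g \<in> ?S" "(fwd_diff ^^ ?q) h = (\<lambda>x. h (x + ?q) - h x + 2 * g x)"
    by blast
  have "(fwd_diff ^^ (Suc m * ?q)) h = (fwd_diff ^^ (m * ?q)) ((fwd_diff ^^ ?q) h)"
    by (simp only: mult_Suc add.commute[of ?q "m * ?q"] funpow_add o_apply)
  then have eq: "(fwd_diff ^^ (Suc m * ?q)) h x =
      (fwd_diff ^^ (m * ?q)) (\<lambda>x. h (x + ?q) - h x) x + 2 * (fwd_diff ^^ (m * ?q)) g x"
    by (simp only: g(2) fwd_diff_pow_add fwd_diff_pow_mult)
  have "res ((fwd_diff ^^ (m * ?q)) (\<lambda>x. h (x + ?q) - h x) x) s = 0"
    using Suc.prems(1) by (intro res_fwd_diff_pow_eq_0) (simp add: res_minus_eq_0_iff)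
  then have "res ((fwd_diff ^^ (m * ?q)) (\<lambda>x. h (x + ?q) - h x) x) (Suc m) = res 0 (Suc m)"
    using Suc.prems(2) res_eq_mono[of _ s 0] by simp
  moreover have "res (2 * (fwd_diff ^^ (m * ?q)) g x) (Suc m) = res 0 (Suc m)"
    using Suc.IH[of g x] g(1) Suc.prems(2) by (simp add: res_double_eq_0)
  ultimately show ?case
    unfolding eq using res_add_cong by fastforce
qed

lemma fwd_diff_pow_tendsto_0:
  fixes f :: "two_adic \<Rightarrow> two_adic"
  assumes "continuous_on UNIV f"
  shows "(\<lambda>n. (fwd_diff ^^ n) (\<lambda>x. f (of_nat x)) 0) \<longlonglongrightarrow> 0"
  unfolding eventually_res_eq_iff
proof
  fix s
  let ?h = "\<lambda>x. f (of_nat x)"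
  obtain t where t: "\<And>y z. res y t = res z t \<Longrightarrow> res (f y) s = res (f z) s"
    using continuous_on_imp_uniform_res[OF assms] by blast
  have per: "res (?h (x + 2 ^ t)) s = res (?h x) s" for x
    by (rule t) (simp only: res_of_nat, simp)
  have "res ((fwd_diff ^^ n) ?h 0) s = 0" if "n \<ge> s * 2 ^ t" for n
  proof -
    \<comment> \<open>After \<open>s * 2 ^ t\<close> differencings the whole sequence vanishes
      modulo \<open>2 ^ s\<close>, and further differencing preserves this.\<close>
    have "(fwd_diff ^^ n) ?h = (fwd_diff ^^ (n - s * 2 ^ t)) ((fwd_diff ^^ (s * 2 ^ t)) ?h)"
      using that by (metis comp_apply funpow_add le_add_diff_inverse2)
    moreover have "res ((fwd_diff ^^ (s * 2 ^ t)) ?h x) s = 0" for x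
      by (rule res_fwd_diff_pow_periodic[where s = s]) (rule per, simp)
    ultimately show ?thesis
      by (metis res_fwd_diff_pow_eq_0)
  qed
  then show "\<forall>\<^sub>F n in sequentially. res ((fwd_diff ^^ n) ?h 0) s = res 0 s"
    by (auto simp: eventually_sequentially)
qed

text \<open>Modulo \<open>2 ^ s\<close>, the value at \<open>T\<close> of a partial sum may be compared with that of \<open>f\<close> at a
  natural number near \<open>T\<close>; so completeness of the 2-adic integers is not needed.\<close>

lemma has_mahler_seriesI:
  assumes cont: "continuous_on UNIV f" and a: "a \<longlonglongrightarrow> 0"
    and nat: "\<And>n. f (of_nat n) = (\<Sum>j\<le>n. of_nat (n choose j) * a j)"
  shows "has_mahler_series f a"
  unfolding has_mahler_series_def
proof (intro conjI a allI)
  fix T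
  show "(\<lambda>j. a j * beta j T) sums f T"
    unfolding sums_def eventually_res_eq_iff
  proof
    fix s
    obtain N where N: "\<And>j. j \<ge> N \<Longrightarrow> res (a j) s = 0"
      using a unfolding eventually_res_eq_iff eventually_sequentially by auto
    have "res (\<Sum>j<M. a j * beta j T) s = res (f T) s" if "M \<ge> N" for M
    proof -
      obtain p where p: "\<And>y. res y p = res T p \<Longrightarrow> res (f y) s = res (f T) s"
        using cont unfolding continuous_on_two_adic_iff by blast
      have "\<forall>j. \<exists>q. \<forall>y. res y q = res T q \<longrightarrow> res (beta j y) s = res (beta j T) s"
        using continuous_on_beta unfolding continuous_on_two_adic_iff by blast
      then obtain q where q: "\<And>j y. res y (q j) = res T (q j) \<Longrightarrow> res (beta j y) s = res (beta j T) s"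
        by metis
      \<comment> \<open>The sum bounds every modulus involved, so one \<open>n\<close> congruent to
        \<open>T\<close> modulo \<open>2 ^ r\<close> serves \<open>f\<close> and the first
        \<open>M\<close> binomial functions at once.\<close>
      define r where "r = p + (\<Sum>j<M. q j)"
      define n where "n = nat (res T r)"
      have n: "res (of_nat n) r = res T r"
        unfolding n_def by (rule res_eq_of_nat[symmetric])
      have qr: "q j \<le> r" if "j < M" for j
        using that member_le_sum[of j "{..<M}" q] by (simp add: r_def)
      \<comment> \<open>The range is extended past both \<open>n\<close> and \<open>M\<close>; the
        terms with \<open>j > n\<close> vanish.\<close>
      have fn: "f (of_nat n) = (\<Sum>j<M + Suc n. a j * beta j (of_nat n))"
      proof -
        have "f (of_nat n) = (\<Sum>j\<le>n. a j * beta j (of_nat n))"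
          by (simp add: nat beta_of_nat mult.commute)
        also have "\<dots> = (\<Sum>j<M + Suc n. a j * beta j (of_nat n))"
          by (rule sum.mono_neutral_left) (auto simp: beta_of_nat)
        finally show ?thesis .
      qed
      have "res (\<Sum>j<M. a j * beta j T) s = res (\<Sum>j<M. a j * beta j (of_nat n)) s"
        by (intro res_sum_cong res_mult_cong refl q[symmetric] res_eq_mono[OF n] qr) auto
      also have "(\<Sum>j<M. a j * beta j (of_nat n)) =
          (\<Sum>j<M + Suc n. if j < M then a j * beta j (of_nat n) else 0)"
        by (rule sum.mono_neutral_cong_left) auto
      \<comment> \<open>For \<open>j \<ge> M\<close> the coefficients vanish modulo
        \<open>2 ^ s\<close>, so the omitted terms may be restored.\<close>
      also have "res \<dots> s = res (f (of_nat n)) s"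
        unfolding fn using N \<open>M \<ge> N\<close>
        by (intro res_sum_cong) (auto simp: times_two_adic.rep_eq)
      also have "\<dots> = res (f T) s"
        by (intro p res_eq_mono[OF n]) (simp add: r_def)
      finally show ?thesis .
    qed
    then show "\<forall>\<^sub>F M in sequentially. res (\<Sum>j<M. a j * beta j T) s = res (f T) s"
      by (auto simp: eventually_sequentially)
  qed
qed

theorem mahler:
  assumes "continuous_on UNIV f"
  shows "\<exists>a. has_mahler_series f a"
  by (rule exI, rule has_mahler_seriesI[OF assms fwd_diff_pow_tendsto_0[OF assms]])
     (rule newton_forward[of "\<lambda>x. f (of_nat x)"])

section \<open>Uniqueness of Mahler coefficients\<close>

lemma has_mahler_series_of_nat:
  assumes "has_mahler_series f a"
  shows "f (of_nat n) = (\<Sum>j\<le>n. a j * of_nat (n choose j))"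
proof -
  have "(\<lambda>j. a j * beta j (of_nat n)) sums f (of_nat n)"
    using assms by (simp add: has_mahler_series_def)
  moreover have "(\<lambda>j. a j * beta j (of_nat n)) sums (\<Sum>j\<le>n. a j * beta j (of_nat n))"
    by (rule sums_finite) (auto simp: beta_of_nat)
  ultimately show ?thesis
    using sums_unique2 by (fastforce simp: beta_of_nat)
qed

text \<open>The values at natural numbers form a triangular system in the coefficients, with
  diagonal entries \<open>n choose n = 1\<close>.\<close>

lemma has_mahler_series_unique:
  assumes "has_mahler_series f a" "has_mahler_series f b"
  shows "a = b"
proof
  fix n
  show "a n = b n"
  proof (induction n rule: less_induct)
    case (less n)
    have "(\<Sum>j\<le>n. a j * of_nat (n choose j)) = (\<Sum>j\<le>n. b j * of_nat (n choose j))"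
      using assms by (metis has_mahler_series_of_nat)
    moreover have "(\<Sum>j<n. a j * of_nat (n choose j)) = (\<Sum>j<n. b j * of_nat (n choose j))"
      using less by simp
    ultimately show ?case
      by (simp add: lessThan_Suc_atMost[symmetric])
  qed
qed

lemma has_mahler_series_fun_unique:
  assumes "has_mahler_series f a" "has_mahler_series g a"
  shows "f = g"
  using assms sums_unique2 unfolding has_mahler_series_def by (intro ext) blast

lemma mahler_coeff_eq: "has_mahler_series f a \<Longrightarrow> mahler_coeff f = a"
  unfolding mahler_coeff_def using has_mahler_series_unique by blast

lemma has_mahler_series_mahler_coeff:
  "continuous_on UNIV f \<Longrightarrow> has_mahler_series f (mahler_coeff f)"
  using mahler mahler_coeff_eq by metis

text \<open>The series has a single term, which makes the pairing with \<open>beta i\<close> read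
  off the coefficient of \<open>x ^ i\<close>.\<close>

lemma mahler_coeff_beta: "mahler_coeff (beta i) = (\<lambda>j. if j = i then 1 else 0)"
proof (rule mahler_coeff_eq)
  let ?d = "\<lambda>j. if j = i then 1 else 0 :: two_adic"
  show "has_mahler_series (beta i) ?d"
  proof (rule has_mahler_seriesI[OF continuous_on_beta])
    show "?d \<longlonglongrightarrow> 0"
      by (rule tendsto_eventually) (auto simp: eventually_sequentially intro: exI[of _ "Suc i"])
    show "beta i (of_nat n) = (\<Sum>j\<le>n. of_nat (n choose j) * ?d j)" for n
      by (auto simp: beta_of_nat if_distrib[of "(*) _"] cong: if_cong)
  qed
qed


section \<open>The Adams operation\<close>

lemma kronecker_X_power: "kronecker (fps_X ^ j) f = mahler_coeff f j"
proof -
  have "kronecker (fps_X ^ j) f = (\<Sum>k\<in>{j}. fps_nth (fps_X ^ j) k * mahler_coeff f k)"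
    unfolding kronecker_def by (rule suminf_finite) auto
  then show ?thesis by simp
qed

lemma kronecker_beta: "kronecker b (beta i) = fps_nth b i"
proof -
  have "kronecker b (beta i) = (\<Sum>k\<in>{i}. fps_nth b k * mahler_coeff (beta i) k)"
    unfolding kronecker_def by (rule suminf_finite) (auto simp: mahler_coeff_beta)
  then show ?thesis by (simp add: mahler_coeff_beta)
qed

section \<open>Binomial expansions of power series\<close>

lemma fps_nth_one_plus_X_power:
  "fps_nth ((1 + fps_X) ^ n :: 'a :: comm_ring_1 fps) i = of_nat (n choose i)"
proof -
  have "fps_nth ((1 + fps_X) ^ n :: 'a fps) i =
      (\<Sum>k\<le>n. of_nat (n choose k) * fps_nth (fps_X ^ k) i)"
    by (simp add: add.commute[of 1] binomial_ring fps_sum_nth fps_of_nat[symmetric])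
  also have "\<dots> = of_nat (n choose i)"
    by (auto simp: not_le binomial_eq_0 if_distrib[of "(*) _"] cong: if_cong)
  finally show ?thesis .
qed

text \<open>Here \<open>(1 + x)\<^sup>3 - 1 = x (3 + x (3 + x))\<close>, and both sums are expanded binomially.\<close>

lemma fps_nth_psi3_X_power:
  "fps_nth (((1 + fps_X) ^ 3 - 1) ^ j :: 'a :: comm_ring_1 fps) i = of_nat (mahler_a i j)"
proof -
  let ?X = "fps_X :: 'a fps"
  have "((1 + ?X) ^ 3 - 1) ^ j = ?X ^ j * (?X * (?X + 3) + 3) ^ j"
    unfolding power_mult_distrib[symmetric] by (simp add: algebra_simps power3_eq_cube)
  also have "\<dots> = ?X ^ j * (\<Sum>s\<le>j. of_nat (j choose s) * (?X ^ s *
      (\<Sum>t\<le>s. of_nat (s choose t) * ?X ^ t * 3 ^ (s - t))) * 3 ^ (j - s))"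
    by (simp only: binomial_ring power_mult_distrib)
  also have "\<dots> = (\<Sum>s\<le>j. \<Sum>t\<le>s.
      of_nat ((j choose s) * (s choose t) * 3 ^ (j - t)) * ?X ^ (s + t + j))"
    unfolding sum_distrib_left sum_distrib_right
  proof (intro sum.cong refl)
    fix s t
    assume "s \<in> {..j}" "t \<in> {..s}"
    then have "j - t = (j - s) + (s - t)" by auto
    then show "?X ^ j * (of_nat (j choose s) * (?X ^ s * (of_nat (s choose t) * ?X ^ t * 3 ^ (s - t)))
        * 3 ^ (j - s)) = of_nat ((j choose s) * (s choose t) * 3 ^ (j - t)) * ?X ^ (s + t + j)"
      by (simp add: power_add algebra_simps)
  qed
  finally have "fps_nth (((1 + ?X) ^ 3 - 1) ^ j) i =
      (\<Sum>s\<le>j. \<Sum>t\<le>s. of_nat ((j choose s) * (s choose t) * 3 ^ (j - t)) *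
        fps_nth (?X ^ (s + t + j)) i)"
    by (simp only: fps_sum_nth fps_of_nat[symmetric] fps_mult_left_const_nth)
  also have "\<dots> = (\<Sum>(s, t)\<in>Sigma {..j} (\<lambda>s. {..s}).
      of_nat ((j choose s) * (s choose t) * 3 ^ (j - t)) * fps_nth (?X ^ (s + t + j)) i)"
    by (subst sum.Sigma) auto
  also have "\<dots> = (\<Sum>(s, t)\<in>{(s, t). s + t + j = i}.
      of_nat ((j choose s) * (s choose t) * 3 ^ (j - t)))"
  \<comment> \<open>The index sets differ by harmless pairs: off \<open>s + t + j = i\<close> the
    monomial has no coefficient at \<open>i\<close>, and off \<open>t \<le> s \<le> j\<close> a
    binomial coefficient vanishes.\<close>
  proof (rule sum.mono_neutral_cong)
    have "{(s, t). s + t + j = i} \<subseteq> {..i} \<times> {..i}" by auto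
    then show "finite {(s, t). s + t + j = i}"
      by (rule finite_subset) simp
    show "(case x of (s, t) \<Rightarrow> (of_nat ((j choose s) * (s choose t) * 3 ^ (j - t)) :: 'a)) = 0"
      if x: "x \<in> {(s, t). s + t + j = i} - Sigma {..j} (\<lambda>s. {..s})" for x
    proof -
      obtain s t where "x = (s, t)" "s > j \<or> t > s"
        using x by fastforce
      then show ?thesis
        by (auto simp: binomial_eq_0)
    qed
  qed auto
  also have "\<dots> = of_nat (mahler_a i j)"
    by (simp add: mahler_a_def case_prod_unfold)
  finally show ?thesis .
qed

lemma mahler_a_eq_0: "j > i \<Longrightarrow> mahler_a i j = 0"
  unfolding mahler_a_def by (rule sum.neutral) auto

text \<open>For \<open>j = 0\<close> a nonzero term forces \<open>s = t = 0\<close>, which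
  contradicts \<open>s + t = i\<close>. Hence the Mahler series may start at 1.\<close>

lemma mahler_a_0_right: "i \<ge> 1 \<Longrightarrow> mahler_a i 0 = 0"
  unfolding mahler_a_def by (rule sum.neutral) auto

lemma has_mahler_series_beta_triple:
  "has_mahler_series (\<lambda>T. beta i (3 * T)) (\<lambda>j. of_nat (mahler_a i j))"
proof (rule has_mahler_seriesI)
  have "res (3 * y) n = res (3 * x) n" if "res y n = res x n" for x y n
    using that by (intro res_mult_cong refl)
  then show "continuous_on UNIV (\<lambda>T. beta i (3 * T))"
    using continuous_on_beta[of i] unfolding continuous_on_two_adic_iff by metis
  show "(\<lambda>j. of_nat (mahler_a i j) :: two_adic) \<longlonglongrightarrow> 0"
    by (rule tendsto_eventually)
       (auto simp: eventually_sequentially mahler_a_eq_0 intro!: exI[of _ "Suc i"])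
  show "beta i (3 * of_nat n) = (\<Sum>j\<le>n. of_nat (n choose j) * of_nat (mahler_a i j))" for n
  proof -
    let ?X = "fps_X :: two_adic fps"
    have "beta i (3 * of_nat n) = fps_nth ((1 + ?X) ^ (3 * n)) i"
      using beta_of_nat[of i "3 * n"] by (simp add: fps_nth_one_plus_X_power)
    \<comment> \<open>Expanding in powers of \<open>(1 + ?X) ^ 3 - 1\<close> turns the coefficient
      of \<open>x ^ i\<close> into Newton's form in \<open>n\<close>.\<close>
    also have "(1 + ?X) ^ (3 * n) = (((1 + ?X) ^ 3 - 1) + 1) ^ n"
      by (simp add: power_mult)
    also have "\<dots> = (\<Sum>j\<le>n. of_nat (n choose j) * ((1 + ?X) ^ 3 - 1) ^ j)"
      by (subst binomial_ring) simp
    finally show ?thesis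
      by (simp only: fps_sum_nth fps_of_nat[symmetric] fps_mult_left_const_nth fps_nth_psi3_X_power)
  qed
qed

lemma is_adams_psi3_X_power:
  assumes "is_adams_psi3 \<psi>"
  shows "\<psi> (fps_X ^ j) = ((1 + fps_X) ^ 3 - 1) ^ j"
proof -
  have one: "\<psi> 1 = 1" and add: "\<psi> (a + b) = \<psi> a + \<psi> b"
    and mult: "\<psi> (a * b) = \<psi> a * \<psi> b" and L: "\<psi> (1 + fps_X) = (1 + fps_X) ^ 3" for a b
    using assms unfolding is_adams_psi3_def taut_line_bundle_def by auto
  \<comment> \<open>This is additivity applied to \<open>L = 1 + x\<close>.\<close>
  have "\<psi> fps_X = (1 + fps_X) ^ 3 - 1"
    using add[of 1 fps_X] by (simp add: one L)
  then show ?thesis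
    by (induction j) (simp_all add: one mult)
qed

theorem lemma9:
  fixes psi3 :: "K_cohomology \<Rightarrow> K_cohomology"
    and psi3_inv :: "(two_adic \<Rightarrow> two_adic) \<Rightarrow> (two_adic \<Rightarrow> two_adic)"
    and i :: nat
  assumes "is_adams_psi3 psi3"
    and "is_kronecker_adjoint psi3 psi3_inv"
    and "i \<ge> 1"
  shows "psi3_inv (beta i) = (\<lambda>T. beta i (3 * T)) \<and>
    has_mahler_series (psi3_inv (beta i)) (\<lambda>j. if j \<ge> 1 then of_nat (mahler_a i j) else 0)"
proof -
  have K: "beta i \<in> K_homology"
    by (simp add: K_homology_def continuous_on_beta)
  then have cont: "continuous_on UNIV (psi3_inv (beta i))"
    and adj: "kronecker (psi3 a) (beta i) = kronecker a (psi3_inv (beta i))" for a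
    using assms(2) unfolding is_kronecker_adjoint_def K_homology_def by auto
  \<comment> \<open>Adjointness at \<open>x ^ j\<close> equates this Mahler coefficient with the
    coefficient of \<open>x ^ i\<close> in \<open>psi3 (x ^ j)\<close>.\<close>
  have "mahler_coeff (psi3_inv (beta i)) j = of_nat (mahler_a i j)" for j
    using adj[of "fps_X ^ j"]
    by (simp add: kronecker_X_power kronecker_beta is_adams_psi3_X_power[OF assms(1)]
        fps_nth_psi3_X_power)
  then have series: "has_mahler_series (psi3_inv (beta i)) (\<lambda>j. of_nat (mahler_a i j))"
    using has_mahler_series_mahler_coeff[OF cont] by presburger
  moreover have "(\<lambda>j. of_nat (mahler_a i j) :: two_adic) =
      (\<lambda>j. if j \<ge> 1 then of_nat (mahler_a i j) else 0)"
    using mahler_a_0_right[OF assms(3)] by (auto simp: not_less_eq_eq)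
  ultimately show ?thesis
    using has_mahler_series_fun_unique[OF series has_mahler_series_beta_triple] by simp
qed

end
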